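(* Let $Q\subseteq\mathbb N$ be an infinite set, and let $\{G_q\}_{q\in Q}$ be a family of graphs such that, for each $q\in Q$, $G_q$ is strongly regular with parameters $(v(q),k(q),\lambda(q),\mu(q))$, where $v,k,\lambda,\mu\in\mathbb Q[q]$ are polynomials. Let $\psi_{G_q}(x)$ be the characteristic polynomial of the adjacency matrix of $G_q$, and write $$\psi_{G_q}(x)=\sum_{r=0}^{v(q)}c_r(q)x^{v(q)-r},\qquad c_r(q)=0\ \text{ for } r>v(q).$$ Then for every $r\ge 0$ there is a polynomial $\varphi_r$ such that $c_r(q)=\varphi_r(q)$ for all $q\in Q$. Thus the characteristic polynomials $\{\psi_{G_q}\}_{q\in Q}$ form a two-level polynomial over $Q$ with degree function $v$ and infinite depth.
   Context: A graph $G$ (finite, simple) is strongly regular with parameters $(v,k,\lambda,\mu)$ if it has $v$ vertices, is $k$-regular, every two adjacent vertices have exactly $\lambda$ common neighbors, and every two (distinct) non-adjacent vertices have exactly $\mu$ common neighbors. Two-level polynomial over $Q$: let $Q\subseteq\mathbb N$ be infinite, let $g\in\mathbb Q[q]$ take nonnegative integer values on $Q$, and let $e:Q\to\mathbb N\cup\{-1,\infty\}$. A family of polynomials $(f_q(n))_{q\in Q}$ is a two-level polynomial over $Q$ of degree function $g$ and depth function $e$ if $f_q(n)$ has degree $g(q)$ for each $q \in Q$ and, writing $f_q(n)=\sum_{r=0}^{\infty}c_r(q)n^{g(q)-r}$ with $c_r(q)=0$ for $r>g(q)$, there exist polynomials $\{\varphi_r(q)\}_{r\ge0}$ such that $c_r(q)=\varphi_r(q)$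 for every $q\in Q$ and every $r\le e(q)$. Infinite depth means $e(q)=\infty$ for all $q\in Q$. *)

theory Defs
  imports
    "Graph_Theory.Pair_Digraph"
    "Jordan_Normal_Form.Char_Poly"
    "HOL-Library.Extended_Real"
begin

section \<open>Strongly regular graphs\<close>

text \<open>A finite simple graph is a \<^const>\<open>pair_graph\<close>: a finite, loopless digraph whose arc set is a
  symmetric set of ordered pairs.\<close>

definition neighbors :: "'a pair_pre_digraph \<Rightarrow> 'a \<Rightarrow> 'a set" where
  "neighbors G x = {w \<in> pverts G. (x, w) \<in> parcs G}"

text \<open>No graph is excluded: for a complete graph the parameter \<open>m\<close>, and for an edgeless graph the
  parameter \<open>l\<close>, is unconstrained.\<close>

definition strongly_regular :: "'a pair_pre_digraph \<Rightarrow> nat \<Rightarrow> nat \<Rightarrow> nat \<Rightarrow> nat \<Rightarrow> bool" where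
  "strongly_regular G n k l m \<longleftrightarrow>
     pair_graph G \<and>
     card (pverts G) = n \<and>
     (\<forall>x\<in>pverts G. card (neighbors G x) = k) \<and>
     (\<forall>x\<in>pverts G. \<forall>y\<in>pverts G. (x, y) \<in> parcs G \<longrightarrow>
        card (neighbors G x \<inter> neighbors G y) = l) \<and>
     (\<forall>x\<in>pverts G. \<forall>y\<in>pverts G. x \<noteq> y \<and> (x, y) \<notin> parcs G \<longrightarrow>
        card (neighbors G x \<inter> neighbors G y) = m)"


section \<open>Characteristic polynomial of a graph\<close>

definition adjacency_mat :: "'a pair_pre_digraph \<Rightarrow> 'a list \<Rightarrow> rat mat" where
  "adjacency_mat G vs =
     mat (length vs) (length vs) (\<lambda>(i, j). if (vs ! i, vs ! j) \<in> parcs G then 1 else 0)"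

text \<open>The vertices are listed in an arbitrary order; \<open>graph_char_poly_eq\<close> below shows that the result
  does not depend on it.\<close>

definition graph_char_poly :: "'a pair_pre_digraph \<Rightarrow> rat poly" where
  "graph_char_poly G = char_poly (adjacency_mat G (SOME vs. distinct vs \<and> set vs = pverts G))"

lemma char_poly_adjacency_mat_reorder:
  assumes "distinct vs" "distinct ws" "set vs = set ws"
  shows "char_poly (adjacency_mat G vs) = char_poly (adjacency_mat G ws)"
proof -
  define n where "n = length ws"
  have "mset vs = mset ws"
    using assms by (simp add: set_eq_iff_mset_eq_distinct)
  then obtain p where p: "p permutes {..<length ws}" "permute_list p ws = vs"
    by (rule mset_eq_permutation)
  have p': "p permutes {0..<n}"
    using p(1) by (simp add: n_def lessThan_atLeast0)
  have len: "length vs = n"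
    using p(2) n_def by auto
  have nth: "vs ! i = ws ! p i" if "i < n" for i
    using p that permute_list_nth n_def by blast
  have pn: "p i < n" if "i < n" for i
    using permutes_in_image[OF p'] that by auto
  have inj: "p i = p j \<longleftrightarrow> i = j" for i j
    using permutes_inj[OF p'] by (auto dest: injD)
  define B where "B = char_poly_matrix (adjacency_mat G ws)"
  define C where "C = transpose_mat (mat n n (\<lambda>(i, j). B $$ (p i, j)))"
  have B: "B \<in> carrier_mat n n"
    by (simp add: B_def char_poly_matrix_def adjacency_mat_def n_def)
  have C: "C \<in> carrier_mat n n"
    by (simp add: C_def)
  have "char_poly_matrix (adjacency_mat G vs) = transpose_mat (mat n n (\<lambda>(i, j). C $$ (p i, j)))"
    by (rule eq_matI)
      (auto simp: C_def B_def char_poly_matrix_def adjacency_mat_def len nth pn inj n_def[symmetric])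
  then have "char_poly (adjacency_mat G vs) = det (mat n n (\<lambda>(i, j). C $$ (p i, j)))"
    unfolding char_poly_def by (subst det_transpose[symmetric, of _ n]) auto
  also have "\<dots> = signof p * det C"
    by (rule det_permute_rows[OF C p'])
  also have "det C = signof p * det B"
    unfolding C_def by (subst det_transpose[of _ n]) (auto intro: det_permute_rows[OF B p'])
  also have "signof p * (signof p * det B) = det B"
    by (simp add: sign_def)
  finally show ?thesis
    by (simp add: B_def char_poly_def)
qed

lemma graph_char_poly_eq:
  assumes "distinct vs" "set vs = pverts G"
  shows "graph_char_poly G = char_poly (adjacency_mat G vs)"
proof -
  have "distinct (SOME vs. distinct vs \<and> set vs = pverts G) \<and>
      set (SOME vs. distinct vs \<and> set vs = pverts G) = pverts G"
    by (rule someI[of _ vs]) (use assms in simp)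
  then show ?thesis
    unfolding graph_char_poly_def using assms by (intro char_poly_adjacency_mat_reorder) auto
qed


section \<open>Two-level polynomials\<close>

text \<open>The coefficients \<open>c\<^sub>r\<close> in \<open>p = (\<Sum>r. c\<^sub>r x\<^bsup>d - r\<^esup>)\<close>, with \<open>c\<^sub>r = 0\<close> for \<open>r > d\<close>.\<close>

definition coeff_from_top :: "nat \<Rightarrow> 'a::zero poly \<Rightarrow> nat \<Rightarrow> 'a" where
  "coeff_from_top d p r = (if r \<le> d then coeff p (d - r) else 0)"

lemma poly_eq_sum_coeff_from_top:
  assumes "degree p \<le> d"
  shows "p = (\<Sum>r\<le>d. monom (coeff_from_top d p r) (d - r))"
proof -
  have "p = (\<Sum>i\<le>d. monom (coeff p i) i)"
    using assms by (rule poly_as_sum_of_monoms'[symmetric])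
  also have "\<dots> = (\<Sum>r\<le>d. monom (coeff p (d - r)) (d - r))"
    by (rule sum.nat_diff_reindex[of "\<lambda>i. monom (coeff p i) i" "Suc d", unfolded lessThan_Suc_atMost,
          simplified, symmetric])
  finally show ?thesis
    by (simp add: coeff_from_top_def)
qed

text \<open>The depth takes values in \<open>\<nat> \<union> {-1, \<infinity>}\<close>, encoded in \<^typ>\<open>ereal\<close>. That the degree function
  \<open>g\<close> is a nonnegative integer on \<open>Q\<close> is part of the degree condition; \<open>f q \<noteq> 0\<close> excludes the zero
  polynomial, whose \<^const>\<open>degree\<close> is \<open>0\<close> by convention.\<close>

definition two_level_polynomial ::
  "nat set \<Rightarrow> rat poly \<Rightarrow> (nat \<Rightarrow> ereal) \<Rightarrow> (nat \<Rightarrow> 'a::field_char_0 poly) \<Rightarrow> bool" where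
  "two_level_polynomial Q g e f \<longleftrightarrow>
     infinite Q \<and>
     (\<forall>q\<in>Q. e q = -1 \<or> e q = \<infinity> \<or> (\<exists>d::nat. e q = ereal (real d))) \<and>
     (\<forall>q\<in>Q. f q \<noteq> 0 \<and> of_nat (degree (f q)) = poly g (of_nat q)) \<and>
     (\<exists>\<phi> :: nat \<Rightarrow> 'a poly. \<forall>q\<in>Q. \<forall>r. ereal (real r) \<le> e q \<longrightarrow>
        coeff_from_top (degree (f q)) (f q) r = poly (\<phi> r) (of_nat q))"

end

theory Submission
  imports Defs
begin

section \<open>Linear algebra: a differential equation for the characteristic polynomial\<close>

text \<open>Let \<open>A\<close> be the adjacency matrix, \<open>p\<close> its characteristic polynomial, \<open>J\<close> the all-ones matrix,
  \<open>a = k - m\<close> and \<open>b = l - m\<close>. From \<open>A\<^sup>2 = a I + b A + m J\<close> and \<open>A J = k J\<close> one finds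
  \<open>(x I - A) N = d I\<close> with \<open>N = (x - k) ((x - b) I + A) + m J\<close> and \<open>d = (x - k) (x\<^sup>2 - b x - a)\<close>.
  Since \<open>p'\<close> is the trace of the adjugate of \<open>x I - A\<close>, this gives \<open>d p' = p tr N\<close>. Comparing
  coefficients expresses \<open>r c\<^sub>r\<close> through \<open>c\<^bsub>r-1\<^esub>\<close>, \<open>c\<^bsub>r-2\<^esub>\<close>, \<open>c\<^bsub>r-3\<^esub>\<close> with multipliers that are polynomials
  in the parameters.\<close>

text \<open>Multiplying \<open>M * N = d I\<close> on the left by the adjugate of \<open>M\<close>
  gives \<open>d adj M = p N\<close> without any division. Its diagonal sums to the claim, since
  \<open>pderiv_char_poly\<close> writes the derivative as the sum of the principal minors of
  \<open>x I - A\<close>.\<close>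

lemma pderiv_char_poly_mult:
  fixes A :: "'a :: idom mat"
  assumes A: "A \<in> carrier_mat n n" and N: "N \<in> carrier_mat n n"
    and inv: "char_poly_matrix A * N = d \<cdot>\<^sub>m 1\<^sub>m n"
  shows "d * pderiv (char_poly A) = char_poly A * (\<Sum>i<n. N $$ (i, i))"
proof -
  define M where "M = char_poly_matrix A"
  have M: "M \<in> carrier_mat n n"
    using A by (simp add: M_def)
  have adj: "adj_mat M \<in> carrier_mat n n" "adj_mat M * M = char_poly A \<cdot>\<^sub>m 1\<^sub>m n"
    using adj_mat[OF M] by (simp_all add: char_poly_def M_def)
  have "d \<cdot>\<^sub>m adj_mat M = adj_mat M * (M * N)"
    using mult_smult_distrib[OF adj(1) one_carrier_mat, of d] adj(1) by (simp add: inv[folded M_def])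
  also have "\<dots> = adj_mat M * M * N"
    by (rule assoc_mult_mat[symmetric, OF adj(1) M N])
  also have "\<dots> = char_poly A \<cdot>\<^sub>m N"
    unfolding adj(2) using N by (simp add: mult_smult_assoc_mat[OF one_carrier_mat N])
  finally have eq: "d \<cdot>\<^sub>m adj_mat M = char_poly A \<cdot>\<^sub>m N" .
  have diag: "d * char_poly (mat_delete A i i) = char_poly A * N $$ (i, i)" if "i < n" for i
  proof -
    \<comment> \<open>Deleting row and column \<open>i\<close> commutes with forming
      \<open>x I - A\<close>, and a diagonal cofactor has sign 1.\<close>
    have "mat_delete M i i = char_poly_matrix (mat_delete A i i)"
      using that A by (intro eq_matI) (auto simp: M_def char_poly_matrix_def mat_delete_def)
    then have "adj_mat M $$ (i, i) = char_poly (mat_delete A i i)"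
      using that M by (simp add: adj_mat_def cofactor_def char_poly_def)
    moreover have "(d \<cdot>\<^sub>m adj_mat M) $$ (i, i) = (char_poly A \<cdot>\<^sub>m N) $$ (i, i)"
      by (simp only: eq)
    ultimately show ?thesis
      using that adj(1) N by simp
  qed
  show ?thesis
    by (simp add: pderiv_char_poly[OF A] sum_distrib_left diag)
qed

text \<open>\<open>square\<close> gives
  \<open>(x I - A) ((x - b) I + A) = (x^2 - b x - a) I - m J\<close>, and \<open>row\<close> gives
  \<open>(x I - A) m J = (x - k) m J\<close>. Scaling the first identity by \<open>x - k\<close> and
  adding the second cancels \<open>J\<close>. By \<open>diag\<close>, \<open>A\<close> adds nothing
  to the trace.\<close>

lemma pderiv_char_poly_quadratic_mat:
  fixes A :: "'a :: idom mat"
  assumes A: "A \<in> carrier_mat n n"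
    and diag: "\<And>i. i < n \<Longrightarrow> A $$ (i, i) = 0"
    and row: "\<And>i. i < n \<Longrightarrow> (\<Sum>j<n. A $$ (i, j)) = k"
    and square: "\<And>i j. i < n \<Longrightarrow> j < n \<Longrightarrow>
      (\<Sum>h<n. A $$ (i, h) * A $$ (h, j)) = (if i = j then a else 0) + b * A $$ (i, j) + m"
  shows "[:-k, 1:] * [:-a, -b, 1:] * pderiv (char_poly A) =
    of_nat n * ([:-k, 1:] * [:-b, 1:] + [:m:]) * char_poly A"
proof -
  define N where "N = mat n n (\<lambda>(i, j).
    [:-k, 1:] * ((if i = j then [:-b, 1:] else 0) + [:A $$ (i, j):]) + [:m:])"
  have N: "N \<in> carrier_mat n n"
    by (simp add: N_def)
  have inv: "char_poly_matrix A * N = ([:-k, 1:] * [:-a, -b, 1:]) \<cdot>\<^sub>m 1\<^sub>m n"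
  proof (rule eq_matI)
    fix i j
    assume "i < dim_row (([:-k, 1:] * [:-a, -b, 1:]) \<cdot>\<^sub>m 1\<^sub>m n)"
      and "j < dim_col (([:-k, 1:] * [:-a, -b, 1:]) \<cdot>\<^sub>m 1\<^sub>m n)"
    then have ij: "i < n" "j < n"
      by auto
    have row': "(\<Sum>h<n. [:A $$ (i, h):]) = [:k:]"
      by (simp add: sum_to_poly row[OF ij(1)])
    have square': "(\<Sum>h<n. [:A $$ (i, h):] * [:A $$ (h, j):]) =
        (if i = j then [:a:] else 0) + [:b:] * [:A $$ (i, j):] + [:m:]"
    proof -
      have "(\<Sum>h<n. [:A $$ (i, h):] * [:A $$ (h, j):]) = [:\<Sum>h<n. A $$ (i, h) * A $$ (h, j):]"
        by (simp add: sum_to_poly mult.commute)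
      then show ?thesis
        by (simp add: square[OF ij])
    qed
    have "(char_poly_matrix A * N) $$ (i, j) =
        (\<Sum>h<n. ((if i = h then [:0, 1:] else 0) - [:A $$ (i, h):]) * N $$ (h, j))"
      using A N ij
      by (auto simp: char_poly_matrix_def scalar_prod_def lessThan_atLeast0 intro!: sum.cong)
    \<comment> \<open>The part \<open>x I\<close> selects one entry of \<open>N\<close>; the other
      sums come from \<open>A\<close> times the three summands of \<open>N\<close>.\<close>
    also have "\<dots> = (\<Sum>h<n. if i = h then [:0, 1:] * N $$ (h, j) else 0) -
        (\<Sum>h<n. if h = j then [:-k, 1:] * [:-b, 1:] * [:A $$ (i, h):] else 0) -
        [:-k, 1:] * (\<Sum>h<n. [:A $$ (i, h):] * [:A $$ (h, j):]) - [:m:] * (\<Sum>h<n. [:A $$ (i, h):])"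
      unfolding sum_distrib_left sum_subtractf[symmetric]
      by (rule sum.cong)
        (use ij in \<open>auto simp: N_def algebra_simps simp del: mult_pCons_left mult_pCons_right\<close>)
    also have "\<dots> = [:0, 1:] * N $$ (i, j) - [:-k, 1:] * [:-b, 1:] * [:A $$ (i, j):] -
        [:-k, 1:] * ((if i = j then [:a:] else 0) + [:b:] * [:A $$ (i, j):] + [:m:]) - [:m:] * [:k:]"
      using ij by (simp only: row' square' sum.delta sum.delta' finite_lessThan lessThan_iff if_True)
    also have "\<dots> = (([:-k, 1:] * [:-a, -b, 1:]) \<cdot>\<^sub>m 1\<^sub>m n) $$ (i, j)"
      using ij by (simp add: N_def algebra_simps)
    finally show "(char_poly_matrix A * N) $$ (i, j) = \<dots>" .
  qed (use A N in \<open>auto simp: char_poly_matrix_def\<close>)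
  have "(\<Sum>i<n. N $$ (i, i)) = of_nat n * ([:-k, 1:] * [:-b, 1:] + [:m:])"
    by (simp add: N_def diag del: mult_pCons_left mult_pCons_right)
  then show ?thesis
    using pderiv_char_poly_mult[OF A N inv] by (simp only: mult.commute)
qed

section \<open>From the differential equation to a coefficient recurrence\<close>

text \<open>Reading the coefficients from degree \<open>n + 3\<close> instead of \<open>n\<close> shifts \<open>c\<^sub>r\<close> to index \<open>r + 3\<close>, so that
  the recurrence needs no special cases for small \<open>r\<close>.\<close>

lemma coeff_from_top_recurrence:
  fixes p :: "'a :: field_char_0 poly"
  assumes ode: "[:d0, d1, d2, 1:] * pderiv p = [:t0, t1, of_nat n:] * p"
  defines "e \<equiv> coeff_from_top (n + 3) p"
  shows "of_nat r * e (r + 3) =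
    (d2 * (of_nat n + 1 - of_nat r) - t1) * e (r + 2) +
    (d1 * (of_nat n + 2 - of_nat r) - t0) * e (r + 1) +
    d0 * (of_nat n + 3 - of_nat r) * e r"
proof -
  have co: "coeff ([:d0, d1, d2, 1:] * pderiv p) i = coeff ([:t0, t1, of_nat n:] * p) i" for i
    by (simp only: ode)
  \<comment> \<open>The instance for \<open>r\<close> is the comparison in degree
    \<open>n + 2 - r\<close>, which exists up to \<open>r = n + 2\<close>. At
    \<open>r = n + 3\<close> only \<open>e r\<close> can be nonzero, and its factor
    \<open>n + 3 - r\<close> vanishes; beyond that every term is zero.\<close>
  consider "r \<le> n" | "r = n + 1" | "r = n + 2" | "r = n + 3" | "r > n + 3"
    by linarith
  then show ?thesis
  proof cases
    case 1
    then obtain j where "n = r + j"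
      by (rule less_eqE)
    then show ?thesis
      using co[of "j + 2", symmetric]
      by (cases j)
        (simp_all add: e_def coeff_from_top_def coeff_pderiv numeral_eq_Suc algebra_simps)
  next
    case 2
    then show ?thesis
      using co[of 1]
      by (simp add: e_def coeff_from_top_def coeff_pderiv numeral_2_eq_2 numeral_3_eq_3
          algebra_simps)
  next
    case 3
    then show ?thesis
      using co[of 0]
      by (simp add: e_def coeff_from_top_def coeff_pderiv numeral_2_eq_2 numeral_3_eq_3
          algebra_simps)
  next
    case 4
    then show ?thesis
      by (simp add: e_def coeff_from_top_def)
  next
    case 5
    then show ?thesis
      by (simp add: e_def coeff_from_top_def)
  qed
qed

section \<open>Application to strongly regular graphs\<close>

lemma degree_monic_graph_char_poly:
  assumes "finite (pverts G)"
  shows "degree (graph_char_poly G) = card (pverts G)" and "lead_coeff (graph_char_poly G) = 1"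
proof -
  obtain vs where vs: "distinct vs" "set vs = pverts G"
    using finite_distinct_list[OF assms] by blast
  then have "adjacency_mat G vs \<in> carrier_mat (card (pverts G)) (card (pverts G))"
    by (simp add: adjacency_mat_def flip: distinct_card)
  then show "degree (graph_char_poly G) = card (pverts G)" "lead_coeff (graph_char_poly G) = 1"
    using degree_monic_char_poly[of "adjacency_mat G vs"] by (simp_all add: graph_char_poly_eq[OF vs])
qed

text \<open>Entries of the squared adjacency matrix count common neighbors: \<open>k = a + m\<close>
  on the diagonal, \<open>l = b + m\<close> for adjacent pairs, \<open>m\<close> otherwise. Hence
  \<open>a = k - m\<close> and \<open>b = l - m\<close>.\<close>

lemma strongly_regular_char_poly_ode:
  assumes "strongly_regular G n k l m"
  shows "[:- rat_of_nat k, 1:] * [:of_nat m - of_nat k, of_nat m - of_nat l, 1:] *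
      pderiv (graph_char_poly G) =
    of_nat n * ([:- of_nat k, 1:] * [:of_nat m - of_nat l, 1:] + [:of_nat m:]) * graph_char_poly G"
proof -
  note G = assms[unfolded strongly_regular_def]
  interpret pair_graph G
    using G by blast
  obtain vs where vs: "distinct vs" "set vs = pverts G"
    using finite_distinct_list[OF pair_finite_verts] by blast
  define A where "A = adjacency_mat G vs"
  have p: "graph_char_poly G = char_poly A"
    unfolding A_def by (rule graph_char_poly_eq[OF vs])
  have len: "length vs = n"
    using G vs distinct_card by fastforce
  have A: "A \<in> carrier_mat n n"
    by (simp add: A_def adjacency_mat_def len)
  have in_V: "vs ! i \<in> pverts G" if "i < n" for i
    using that vs(2) len nth_mem by blast
  have nth_eq: "vs ! i = vs ! j \<longleftrightarrow> i = j" if "i < n" "j < n" for i j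
    using that vs(1) len by (simp add: nth_eq_iff_index_eq)
  have sum_V: "(\<Sum>i<n. f (vs ! i)) = sum f (pverts G)" for f :: "'a \<Rightarrow> rat"
    using bij_betw_nth[OF vs(1) refl refl] len vs(2)
    by (auto intro: sum.reindex_bij_betw)
  have adj: "A $$ (i, j) = (if (vs ! i, vs ! j) \<in> parcs G then 1 else 0)" if "i < n" "j < n" for i j
    using that by (simp add: A_def adjacency_mat_def len)
  have sym: "(y, x) \<in> parcs G \<longleftrightarrow> (x, y) \<in> parcs G" for x y
    using pair_sym_arcs by (auto simp: symmetric_def dest: symD)
  have loopfree: "(x, x) \<notin> parcs G" for x
    using pair_no_loops by force
  have "[:- rat_of_nat k, 1:] * [:- (of_nat k - of_nat m), - (of_nat l - of_nat m), 1:] *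
      pderiv (char_poly A) =
    of_nat n * ([:- of_nat k, 1:] * [:- (of_nat l - of_nat m), 1:] + [:of_nat m:]) * char_poly A"
  proof (rule pderiv_char_poly_quadratic_mat[OF A])
    fix i assume i: "i < n"
    show "A $$ (i, i) = 0"
      using i loopfree by (simp add: adj)
    have "(\<Sum>j<n. A $$ (i, j)) = (\<Sum>y\<in>pverts G. if (vs ! i, y) \<in> parcs G then 1 else 0)"
      using i by (simp add: adj flip: sum_V)
    also have "\<dots> = of_nat (card (neighbors G (vs ! i)))"
      using pair_finite_verts by (simp add: neighbors_def sum.If_cases Int_def)
    finally show "(\<Sum>j<n. A $$ (i, j)) = of_nat k"
      using G in_V i by simp
  next
    fix i j assume i: "i < n" and j: "j < n"
    have "(\<Sum>h<n. A $$ (i, h) * A $$ (h, j)) =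
        (\<Sum>y\<in>pverts G. if (vs ! i, y) \<in> parcs G \<and> (vs ! j, y) \<in> parcs G then 1 else 0)"
      \<comment> \<open>By symmetry of the arcs, each product is the indicator of a common
        neighbor.\<close>
      unfolding sum_V[symmetric] by (rule sum.cong) (use i j sym in \<open>auto simp: adj\<close>)
    also have "\<dots> = of_nat (card (neighbors G (vs ! i) \<inter> neighbors G (vs ! j)))"
    proof -
      have "pverts G \<inter> {y. (vs ! i, y) \<in> parcs G \<and> (vs ! j, y) \<in> parcs G} =
          neighbors G (vs ! i) \<inter> neighbors G (vs ! j)"
        by (auto simp: neighbors_def)
      then show ?thesis
        using pair_finite_verts by (simp add: sum.If_cases)
    qed
    also have "\<dots> = (if i = j then of_nat k - of_nat m else 0) +
        (of_nat l - of_nat m) * A $$ (i, j) + of_nat m"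
      using G in_V i j loopfree by (auto simp: adj nth_eq)
    finally show "(\<Sum>h<n. A $$ (i, h) * A $$ (h, j)) = \<dots>" .
  qed
  then show ?thesis
    by (simp only: p minus_diff_eq)
qed

text \<open>The first multiplier is \<open>n (b + k) - (b + k) (n + 1 - r)\<close>, where
  \<open>n\<close> cancels. For fixed \<open>r\<close> all multipliers are polynomials in
  \<open>n\<close>, \<open>k\<close>, \<open>l\<close>, \<open>m\<close>, which is what the
  induction over coefficients needs.\<close>

lemma strongly_regular_coeff_recurrence:
  fixes r :: nat
  assumes "strongly_regular G n k l m"
  defines "e \<equiv> coeff_from_top (n + 3) (graph_char_poly G)"
    and "a \<equiv> rat_of_nat k - of_nat m" and "b \<equiv> rat_of_nat l - of_nat m"
  shows "of_nat r * e (r + 3) =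
    (of_nat r - 1) * (b + of_nat k) * e (r + 2) +
    ((b * of_nat k - a) * (of_nat n + 2 - of_nat r) - of_nat n * (b * of_nat k + of_nat m)) * e (r + 1) +
    a * of_nat k * (of_nat n + 3 - of_nat r) * e r"
proof -
  have "of_nat r * e (r + 3) =
    (- (b + of_nat k) * (of_nat n + 1 - of_nat r) - (- of_nat n * (b + of_nat k))) * e (r + 2) +
    ((b * of_nat k - a) * (of_nat n + 2 - of_nat r) - of_nat n * (b * of_nat k + of_nat m)) * e (r + 1) +
    a * of_nat k * (of_nat n + 3 - of_nat r) * e r"
    unfolding e_def
  proof (rule coeff_from_top_recurrence)
    have d: "[:a * of_nat k, b * of_nat k - a, - (b + of_nat k), 1:] =
        [:- of_nat k, 1:] * [:of_nat m - of_nat k, of_nat m - of_nat l, 1:]"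
      by (simp add: a_def b_def algebra_simps)
    have t: "[:of_nat n * (b * of_nat k + of_nat m), - of_nat n * (b + of_nat k), of_nat n:] =
        of_nat n * ([:- of_nat k, 1:] * [:of_nat m - of_nat l, 1:] + [:of_nat m:])"
      by (simp add: a_def b_def of_nat_poly algebra_simps)
    show "[:a * of_nat k, b * of_nat k - a, - (b + of_nat k), 1:] * pderiv (graph_char_poly G) =
        [:of_nat n * (b * of_nat k + of_nat m), - of_nat n * (b + of_nat k), of_nat n:] *
        graph_char_poly G"
      unfolding d t by (rule strongly_regular_char_poly_ode[OF assms(1)])
  qed
  then show ?thesis
    by (simp add: algebra_simps)
qed

section \<open>Polynomiality of every coefficient, by induction\<close>

theorem theorem2p5:
  fixes Q :: "nat set"
    and G :: "nat \<Rightarrow> 'a pair_pre_digraph"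
    and v k l m :: "nat \<Rightarrow> nat"
    and pv pk pl pm :: "rat poly"
  assumes "infinite Q"
    and "\<And>q. q \<in> Q \<Longrightarrow> strongly_regular (G q) (v q) (k q) (l q) (m q)"
    and "\<And>q. q \<in> Q \<Longrightarrow> of_nat (v q) = poly pv (of_nat q)"
    and "\<And>q. q \<in> Q \<Longrightarrow> of_nat (k q) = poly pk (of_nat q)"
    and "\<And>q. q \<in> Q \<Longrightarrow> of_nat (l q) = poly pl (of_nat q)"
    and "\<And>q. q \<in> Q \<Longrightarrow> of_nat (m q) = poly pm (of_nat q)"
  shows "(\<forall>r. \<exists>\<phi> :: rat poly. \<forall>q\<in>Q.
            coeff_from_top (v q) (graph_char_poly (G q)) r = poly \<phi> (of_nat q))
       \<and> two_level_polynomial Q pv (\<lambda>_. \<infinity>) (\<lambda>q. graph_char_poly (G q))"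
proof -
  define e where "e q = coeff_from_top (v q + 3) (graph_char_poly (G q))" for q
  have degree: "degree (graph_char_poly (G q)) = v q"
    and monic: "lead_coeff (graph_char_poly (G q)) = 1" if "q \<in> Q" for q
  proof -
    have "finite (pverts (G q))" "card (pverts (G q)) = v q"
      using assms(2)[OF that]
      by (simp_all add: strongly_regular_def pair_graph_def pair_digraph_def
          pair_fin_digraph.pair_finite_verts)
    then show "degree (graph_char_poly (G q)) = v q" "lead_coeff (graph_char_poly (G q)) = 1"
      using degree_monic_graph_char_poly[of "G q"] by simp_all
  qed
  have e_polynomial: "\<exists>\<phi> :: rat poly. \<forall>q\<in>Q. e q s = poly \<phi> (of_nat q)" for s
  proof (induction s rule: less_induct)
    case (less s)
    consider "s < 3" | "s = 3" | r where "r > 0" "s = r + 3"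
      using less_imp_add_positive[of 3 s] by (metis add.commute linorder_neqE_nat)
    then show ?case
    proof cases
      \<comment> \<open>Indices below 3 read coefficients above the degree
        \<open>v q\<close>.\<close>
      case 1
      then have "e q s = 0" if "q \<in> Q" for q
        using degree[OF that] by (simp add: e_def coeff_from_top_def coeff_eq_0)
      then show ?thesis
        by (intro exI[of _ 0]) simp
    next
      \<comment> \<open>At \<open>r = 0\<close> the recurrence does not determine
        \<open>e q 3\<close>, so monicity supplies the starting value.\<close>
      case 2
      then have "e q s = 1" if "q \<in> Q" for q
        using degree[OF that] monic[OF that] by (simp add: e_def coeff_from_top_def)
      then show ?thesis
        by (intro exI[of _ 1]) simp
    next
      case 3
      obtain \<phi>2 \<phi>1 \<phi>0 :: "rat poly" where \<phi>: "\<And>q. q \<in> Q \<Longrightarrow> e q (r + 2) = poly \<phi>2 (of_nat q)"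
        "\<And>q. q \<in> Q \<Longrightarrow> e q (r + 1) = poly \<phi>1 (of_nat q)"
        "\<And>q. q \<in> Q \<Longrightarrow> e q r = poly \<phi>0 (of_nat q)"
        using less[of "r + 2"] less[of "r + 1"] less[of r] 3 by auto
      define pa pb where "pa = pk - pm" and "pb = pl - pm"
      \<comment> \<open>This is the right side of the recurrence with the parameter polynomials in
        place of the parameters. Division by \<open>r > 0\<close> keeps the coefficients rational,
        and \<open>r\<close> does not depend on \<open>q\<close>, so one polynomial serves all of
        \<open>Q\<close>.\<close>
      define \<phi> where "\<phi> = Polynomial.smult (1 / of_nat r)
        (of_int (int r - 1) * (pb + pk) * \<phi>2 +
         ((pb * pk - pa) * (pv + 2 - of_nat r) - pv * (pb * pk + pm)) * \<phi>1 +
         pa * pk * (pv + 3 - of_nat r) * \<phi>0)"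
      have "e q s = poly \<phi> (of_nat q)" if "q \<in> Q" for q
      proof -
        have "of_nat r * e q s = of_nat r * poly \<phi> (of_nat q)"
          unfolding 3(2) e_def strongly_regular_coeff_recurrence[OF assms(2)[OF that]]
          unfolding e_def[symmetric] \<phi>[OF that] assms(3-6)[OF that]
          using 3(1) by (simp add: \<phi>_def pa_def pb_def)
        then show ?thesis
          using 3(1) by simp
      qed
      then show ?thesis
        by blast
    qed
  qed
  have e_shift: "coeff_from_top (v q) (graph_char_poly (G q)) r = e q (r + 3)" for q r
    by (simp add: e_def coeff_from_top_def)
  have coeffs: "\<forall>r. \<exists>\<phi> :: rat poly. \<forall>q\<in>Q.
      coeff_from_top (v q) (graph_char_poly (G q)) r = poly \<phi> (of_nat q)"
    unfolding e_shift using e_polynomial by blast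
  \<comment> \<open>The two-level definition asks for one sequence of polynomials, hence a choice
    over all \<open>r\<close>.\<close>
  then obtain \<Phi> :: "nat \<Rightarrow> rat poly" where
    \<Phi>: "\<forall>r. \<forall>q\<in>Q. coeff_from_top (v q) (graph_char_poly (G q)) r = poly (\<Phi> r) (of_nat q)"
    by metis
  have "graph_char_poly (G q) \<noteq> 0" if "q \<in> Q" for q
    using monic[OF that] by auto
  then have "two_level_polynomial Q pv (\<lambda>_. \<infinity>) (\<lambda>q. graph_char_poly (G q))"
    unfolding two_level_polynomial_def using assms(1,3) degree \<Phi> by auto
  with coeffs show ?thesis
    by blast
qed

end
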